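(* Let $g \geq 2$ be an integer. For every $i \in \{0,1,2,\ldots\}$ let $U_i$ be a proper subset of $\{0,1,\ldots,g-1\}$, and let $\mathcal{U} = (U_i)_{i=0}^{\infty}$. Assume: (i) the set $\mathcal{M} = \{m \in \mathbf{N} : U_{m-1} \neq \{1,2,\ldots,g-1\}\}$ is infinite; and (ii) there exist nonnegative real numbers $\alpha_0, \alpha_1, \ldots, \alpha_{g-1}$ and $\beta$ such that, for all $m \in \mathbf{N}$ and $k \in \{0,1,\ldots,g-1\}$, \[ \#\{i \in \{0,1,\ldots,m-1\} : |U_i| = k\} = \alpha_k m + \varepsilon_k(m) \] with \[ |\varepsilon_k(m)| < \beta . \] Let $A_{g,\mathcal{U}}$ be the set of positive integers $n$ whose $g$-adic representation $n = \sum_{i=0}^{m-1} c_i g^i$ (with $c_i \in \{0,\ldots,g-1\}$ and $c_{m-1} \neq 0$) satisfies $c_i \notin U_i$ for all $i \in \{0,\ldots,m-1\}$. Then the Dirichlet series \[ F_{A_{g,\mathcal{U}}}(s) = \sum_{a \in A_{g,\mathcal{U}}} \frac{1}{a^s} \] has abscissa of convergence \[ \sigma_c = \frac{1}{\log g} \sum_{k=0}^{g-1} \alpha_k \log(g-k), \] and moreover the series $F_{A_{g,\mathcal{U}}}(\sigma_c) = \sum_{a \in A_{g,\mathcal{U}}} a^{-\sigma_c}$ diverges.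
   Context: $\mathbf{N} = \{1,2,3,\ldots\}$. Every positive integer $n$ has a unique $g$-adic representation $n=\sum_{i=0}^{m-1} c_i g^i$ with digits $c_i\in\{0,1,\ldots,g-1\}$ and leading digit $c_{m-1}\neq 0$, where $m$ is such that $g^{m-1}\le n\le g^m-1$. The abscissa of convergence of a Dirichlet series $\sum a^{-s}$ is the infimum of real $\sigma$ such that the series converges for $\Re(s)>\sigma$. *)

theory Defs
  imports "HOL-Analysis.Analysis"
begin

(* Only the values c 0, ..., c (m - 1) are constrained. *)
definition gadic_rep :: "nat \<Rightarrow> nat \<Rightarrow> nat \<Rightarrow> (nat \<Rightarrow> nat) \<Rightarrow> bool" where
  "gadic_rep g n m c \<longleftrightarrow>
     m \<ge> 1 \<and> n = (\<Sum>i<m. c i * g ^ i) \<and> (\<forall>i<m. c i \<in> {0..g-1}) \<and> c (m - 1) \<noteq> 0"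

(* For g \<ge> 2 the representation of a positive integer exists and is unique, so the existential
   quantifier speaks about the g-adic representation of n. *)
definition missing_digits_set :: "nat \<Rightarrow> (nat \<Rightarrow> nat set) \<Rightarrow> nat set" where
  "missing_digits_set g U =
     {n. n \<ge> 1 \<and> (\<exists>m c. gadic_rep g n m c \<and> (\<forall>i<m. c i \<notin> U i))}"

(* The terms of the series, a in A, are taken in increasing order of a: convergence means
   convergence of the partial sums over all a in A with a < N. *)
definition dirichlet_term :: "nat set \<Rightarrow> complex \<Rightarrow> nat \<Rightarrow> complex" where
  "dirichlet_term A s n = (if n \<in> A then 1 / of_nat n powr s else 0)"

definition dirichlet_converges :: "nat set \<Rightarrow> complex \<Rightarrow> bool" where
  "dirichlet_converges A s \<longleftrightarrow> summable (dirichlet_term A s)"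

(* Extended real valued, so that the infimum is meaningful when the set of admissible \<sigma> is empty
   or unbounded below. *)
definition abscissa_of_convergence :: "nat set \<Rightarrow> ereal" where
  "abscissa_of_convergence A =
     Inf (ereal ` {\<sigma>::real. \<forall>s::complex. Re s > \<sigma> \<longrightarrow> dirichlet_converges A s})"

end

theory Submission
  imports Defs
begin

text \<open>
  Write $P(m) = \prod_{i<m} (g - |U_i|)$. Hypothesis (ii) says that $\log P(m) = m\,\sigma_c \log g + O(1)$,
  so $P(m)$ lies between constant multiples of $g^{m\sigma_c}$. The block of $A$ in
  $[g^m, g^{m+1})$ has at most $P(m+1)$ elements, so the series at $s$ is dominated by a
  geometric series of ratio $g^{\sigma_c - \Re s}$. By (i), for infinitely many $m$ a nonzero
  leading digit is available and the block has at least $P(m)$ elements; each such block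
  contributes at least a fixed positive amount at $\sigma_c$, and Cauchy's criterion fails.
\<close>

section \<open>Numbers with prescribed digit sets\<close>

text \<open>Unlike in \<open>gadic_rep\<close>, the top digit may be zero, so the positions are
  independent and the count is an exact product.\<close>

definition digit_sums :: "nat \<Rightarrow> (nat \<Rightarrow> nat set) \<Rightarrow> nat \<Rightarrow> nat set" where
  "digit_sums g D m = {n. \<exists>c. n = (\<Sum>i<m. c i * g ^ i) \<and> (\<forall>i<m. c i \<in> D i)}"

lemma digit_sums_0: "digit_sums g D 0 = {0}"
  by (simp add: digit_sums_def)

text \<open>Splitting off the top digit is the recursion behind both the size bound and the
  count.\<close>

lemma digit_sums_Suc:
  "digit_sums g D (Suc m) = (\<lambda>(a, d). a + d * g ^ m) ` (digit_sums g D m \<times> D m)"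
proof (intro equalityI subsetI)
  fix n assume "n \<in> digit_sums g D (Suc m)"
  then obtain c where c: "n = (\<Sum>i<Suc m. c i * g ^ i)" "\<forall>i<Suc m. c i \<in> D i"
    by (auto simp: digit_sums_def)
  then have "(\<Sum>i<m. c i * g ^ i) \<in> digit_sums g D m" "c m \<in> D m"
    by (auto simp: digit_sums_def)
  then show "n \<in> (\<lambda>(a, d). a + d * g ^ m) ` (digit_sums g D m \<times> D m)"
    using c(1) by force
next
  fix n assume "n \<in> (\<lambda>(a, d). a + d * g ^ m) ` (digit_sums g D m \<times> D m)"
  then obtain c d where c: "n = (\<Sum>i<m. c i * g ^ i) + d * g ^ m" "\<forall>i<m. c i \<in> D i" "d \<in> D m"
    by (auto simp: digit_sums_def)
  then have "n = (\<Sum>i<Suc m. (c(m := d)) i * g ^ i)" "\<forall>i<Suc m. (c(m := d)) i \<in> D i"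
    by (auto simp: less_Suc_eq)
  then show "n \<in> digit_sums g D (Suc m)"
    unfolding digit_sums_def by blast
qed

lemma digit_sums_less:
  assumes "g \<ge> 1" "\<And>i. D i \<subseteq> {..<g}" "n \<in> digit_sums g D m"
  shows "n < g ^ m"
  using assms(3)
proof (induction m arbitrary: n)
  case 0
  then show ?case by (simp add: digit_sums_0)
next
  case (Suc m)
  then obtain a d where n: "n = a + d * g ^ m" "a \<in> digit_sums g D m" "d \<in> D m"
    by (auto simp: digit_sums_Suc)
  then have "a < g ^ m" "Suc d \<le> g"
    using Suc.IH assms(2)[of m] by auto
  \<comment> \<open>The lower part is less than one unit of the top position, so it cannot carry
    past digit \<open>d\<close>.\<close>
  then have "n < Suc d * g ^ m" and "Suc d * g ^ m \<le> g * g ^ m"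
    using n(1) by (simp, intro mult_right_mono) auto
  then show ?case by simp
qed

text \<open>Reduction modulo \<open>g ^ m\<close> recovers the lower part, which is below
  \<open>g ^ m\<close>; cancelling it recovers the top digit.\<close>

lemma digit_sums_inj:
  assumes "g \<ge> 1" "\<And>i. D i \<subseteq> {..<g}"
  shows "inj_on (\<lambda>(a, d). a + d * g ^ m) (digit_sums g D m \<times> E)"
proof (rule inj_onI, clarify)
  fix a d a' d'
  assume "a \<in> digit_sums g D m" "a' \<in> digit_sums g D m" and eq: "a + d * g ^ m = a' + d' * g ^ m"
  then have lt: "a < g ^ m" "a' < g ^ m"
    using digit_sums_less[OF assms] by auto
  have "(a + d * g ^ m) mod g ^ m = (a' + d' * g ^ m) mod g ^ m"
    using eq by simp
  then have "a = a'"
    using lt by simp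
  then show "a = a' \<and> d = d'"
    using eq assms(1) by simp
qed

lemma finite_digit_sums:
  assumes "g \<ge> 1" "\<And>i. D i \<subseteq> {..<g}"
  shows "finite (digit_sums g D m)"
  by (rule finite_subset[of _ "{..<g ^ m}"]) (use digit_sums_less[OF assms] in auto)

lemma card_digit_sums:
  assumes "g \<ge> 1" "\<And>i. D i \<subseteq> {..<g}"
  shows "card (digit_sums g D m) = (\<Prod>i<m. card (D i))"
proof (induction m)
  case (Suc m)
  then show ?case
    by (simp add: digit_sums_Suc card_image[OF digit_sums_inj[OF assms]] card_cartesian_product)
qed (simp add: digit_sums_0)

section \<open>Blocks of the set between consecutive powers of \<open>g\<close>\<close>

text \<open>The nonzero leading digit gives \<open>g ^ (m - 1) \<le> n < g ^ m\<close>; comparison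
  with the block forces the length to be \<open>Suc M\<close>. This yields the upper count.\<close>

lemma missing_digits_block_subset:
  assumes "g \<ge> 2" "n \<in> missing_digits_set g U" "g ^ M \<le> n" "n < g ^ Suc M"
  shows "n \<in> digit_sums g (\<lambda>i. {..<g} - U i) (Suc M)"
proof -
  obtain m c where rep: "m \<ge> 1" "n = (\<Sum>i<m. c i * g ^ i)" "\<forall>i<m. c i \<in> {0..g-1}" "c (m - 1) \<noteq> 0"
    and nU: "\<forall>i<m. c i \<notin> U i"
    using assms(2) by (auto simp: missing_digits_set_def gadic_rep_def)
  have D: "\<forall>i<m. c i \<in> {..<g} - U i"
    using rep(3) nU assms(1) by fastforce
  then have n: "n \<in> digit_sums g (\<lambda>i. {..<g} - U i) m"
    using rep(2) unfolding digit_sums_def by blast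
  then have up: "n < g ^ m"
    using assms(1) by (intro digit_sums_less[of g "\<lambda>i. {..<g} - U i"]) auto
  have "g ^ (m - 1) \<le> c (m - 1) * g ^ (m - 1)"
    using rep(4) by simp
  also have "\<dots> \<le> n"
    unfolding rep(2) by (rule member_le_sum) (use rep(1) in auto)
  finally have low: "g ^ (m - 1) \<le> n" .
  have "g ^ M < g ^ m"
    using assms(3) up by linarith
  then have "M < m"
    using assms(1) power_less_imp_less_exp[of g M m] by simp
  moreover have "g ^ (m - 1) < g ^ Suc M"
    using assms(4) low by linarith
  then have "m - 1 < Suc M"
    using assms(1) power_less_imp_less_exp[of g "m - 1" "Suc M"] by simp
  ultimately have "m = Suc M"
    by simp
  then show ?thesis
    using n by simp
qed

text \<open>Prefixing a fixed admissible nonzero digit to all admissible lower parts fills the block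
  with distinct elements; this yields the lower count.\<close>

lemma missing_digits_leading_digit:
  assumes "g \<ge> 2" "a \<in> digit_sums g (\<lambda>i. {..<g} - U i) M" "d \<in> {1..<g} - U M"
  shows "a + d * g ^ M \<in> missing_digits_set g U \<inter> {g ^ M..<g ^ Suc M}"
proof -
  obtain c where c: "a = (\<Sum>i<M. c i * g ^ i)" "\<forall>i<M. c i \<in> {..<g} - U i"
    using assms(2) by (auto simp: digit_sums_def)
  let ?c = "c(M := d)"
  have rep: "gadic_rep g (a + d * g ^ M) (Suc M) ?c"
    unfolding gadic_rep_def
  proof (intro conjI)
    show "\<forall>i<Suc M. ?c i \<in> {0..g-1}"
      using c(2) assms(1,3) by (fastforce simp: less_Suc_eq)
  qed (use c(1) assms(3) in auto)
  have nU: "\<forall>i<Suc M. ?c i \<notin> U i"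
    using c(2) assms(3) by (auto simp: less_Suc_eq)
  have low: "g ^ M \<le> d * g ^ M"
    using assms(3) by simp
  have "a + d * g ^ M \<in> digit_sums g (\<lambda>i. {..<g} - U i) (Suc M)"
    unfolding digit_sums_Suc using assms(2,3) by force
  then have "a + d * g ^ M < g ^ Suc M"
    using assms(1) by (intro digit_sums_less[of g "\<lambda>i. {..<g} - U i"]) auto
  moreover have "1 \<le> g ^ M"
    using assms(1) by simp
  then have "1 \<le> a + d * g ^ M"
    using low by linarith
  then have "a + d * g ^ M \<in> missing_digits_set g U"
    unfolding missing_digits_set_def using rep nU by blast
  moreover have "g ^ M \<le> a + d * g ^ M"
    using low by linarith
  ultimately show ?thesis
    by simp
qed

text \<open>Rewrites the logarithm of the digit product in terms of the frequencies that hypothesis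
  (ii) controls.\<close>

lemma sum_group_by_value:
  fixes f :: "nat \<Rightarrow> 'a" and h :: "'a \<Rightarrow> real"
  assumes "\<And>i. f i \<in> K" "finite K"
  shows "(\<Sum>i<m. h (f i)) = (\<Sum>k\<in>K. real (card {i\<in>{..<m}. f i = k}) * h k)"
proof -
  have "(\<Sum>i<m. h (f i)) = (\<Sum>k\<in>K. \<Sum>i\<in>{i\<in>{..<m}. f i = k}. h (f i))"
    by (rule sum.group[symmetric]) (use assms in auto)
  also have "\<dots> = (\<Sum>k\<in>K. real (card {i\<in>{..<m}. f i = k}) * h k)"
    by (rule sum.cong) auto
  finally show ?thesis .
qed

section \<open>Convergence and divergence from block counts\<close>

text \<open>At \<open>n = 0\<close> both sides vanish, because \<open>0 powr _ = 0\<close> and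
  \<open>1 / 0 = 0\<close>.\<close>

lemma dirichlet_term_of_real:
  "dirichlet_term A (complex_of_real x) n = complex_of_real (if n \<in> A then real n powr - x else 0)"
  using powr_of_real[of "real n" x]
  by (simp add: dirichlet_term_def powr_minus_divide)

lemma norm_dirichlet_term:
  assumes "0 \<notin> A"
  shows "norm (dirichlet_term A s n) = (if n \<in> A then real n powr - Re s else 0)"
proof (cases "n \<in> A")
  case True
  then have "n \<noteq> 0"
    using assms by metis
  then have "norm (of_nat n powr s) = real n powr Re s"
    by (simp add: norm_powr_real_powr)
  then show ?thesis
    using True by (simp add: dirichlet_term_def norm_divide powr_minus_divide)
qed (simp add: dirichlet_term_def)

text \<open>With \<open>t = Re s\<close>, a block has at most \<open>C * g powr (x * M)\<close>
  terms, each of norm at most \<open>g powr (- t * M)\<close>. The norms are thus dominated by a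
  geometric series of ratio \<open>g powr (x - t) < 1\<close>, and convergence is absolute.\<close>

lemma dirichlet_converges_if_block_bound:
  fixes C x :: real
  assumes "g \<ge> 2" "0 \<notin> A" "x \<ge> 0" "Re s > x"
    and bound: "\<And>M. card (A \<inter> {g ^ M..<g ^ Suc M}) \<le> C * real g powr (x * M)"
  shows "dirichlet_converges A s"
proof -
  define t where "t = Re s"
  define f where "f n = norm (dirichlet_term A s n)" for n
  define q where "q = real g powr (x - t)"
  have f_eq: "f n = (if n \<in> A then real n powr - t else 0)" for n
    by (simp add: f_def t_def norm_dirichlet_term assms(2))
  have f_nonneg: "f n \<ge> 0" for n
    by (simp add: f_def)
  have t: "t > x" "t \<ge> 0"
    using assms by (auto simp: t_def)
  have q: "0 < q" "q < 1"
    using assms(1) t by (auto simp: q_def powr_less_one)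
  \<comment> \<open>The bound at \<open>M = 0\<close> reads \<open>card _ \<le> C\<close>.\<close>
  have C: "C \<ge> 0"
    using order_trans[OF of_nat_0_le_iff bound[of 0]] assms(1) by simp
  have block: "(\<Sum>n\<in>{g ^ M..<g ^ Suc M}. f n) \<le> C * q ^ M" for M
  proof -
    have "(\<Sum>n\<in>{g ^ M..<g ^ Suc M}. f n) = (\<Sum>n\<in>A \<inter> {g ^ M..<g ^ Suc M}. real n powr - t)"
      by (subst Int_commute, subst sum.inter_restrict) (auto simp: f_eq)
    also have "\<dots> \<le> (\<Sum>n\<in>A \<inter> {g ^ M..<g ^ Suc M}. real g powr (- t * M))"
    proof (rule sum_mono)
      fix n assume "n \<in> A \<inter> {g ^ M..<g ^ Suc M}"
      then have "real (g ^ M) \<le> real n"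
        by (metis IntD2 atLeastLessThan_iff of_nat_mono)
      then have "real n powr - t \<le> real (g ^ M) powr - t"
        using assms(1) t by (intro powr_mono2') auto
      also have "real (g ^ M) powr - t = real g powr (- t * M)"
        using assms(1) by (simp add: powr_realpow[symmetric] powr_powr mult.commute)
      finally show "real n powr - t \<le> real g powr (- t * M)" .
    qed
    also have "\<dots> = card (A \<inter> {g ^ M..<g ^ Suc M}) * real g powr (- t * M)"
      by simp
    also have "\<dots> \<le> C * real g powr (x * M) * real g powr (- t * M)"
      by (rule mult_right_mono[OF bound]) simp
    also have "\<dots> = C * q ^ M"
      using assms(1) by (simp add: q_def powr_realpow[symmetric] powr_powr powr_add[symmetric] algebra_simps)
    finally show ?thesis .
  qed
  \<comment> \<open>The blocks start at \<open>g ^ 0 = 1\<close>, so index 0 is accounted for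
    separately.\<close>
  have partial: "(\<Sum>n<g ^ M. f n) \<le> f 0 + (\<Sum>i<M. C * q ^ i)" for M
  proof (induction M)
    case (Suc M)
    have "g ^ M \<le> g ^ Suc M"
      using assms(1) by simp
    then have "(\<Sum>n<g ^ Suc M. f n) = (\<Sum>n<g ^ M. f n) + (\<Sum>n\<in>{g ^ M..<g ^ Suc M}. f n)"
      by (simp add: sum.atLeastLessThan_concat flip: atLeast0LessThan del: power_Suc)
    then show ?case
      using Suc block[of M] by simp
  qed simp
  have "summable f"
  proof (rule summableI_nonneg_bounded)
    fix N
    have "N \<le> g ^ N"
      using assms(1) by (metis less_exp le_less order.trans power_mono zero_le)
    then have "(\<Sum>n<N. f n) \<le> (\<Sum>n<g ^ N. f n)"
      by (intro sum_mono2) (auto simp: f_nonneg)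
    also have "\<dots> \<le> f 0 + (\<Sum>i<N. C * q ^ i)"
      by (rule partial)
    also have "(\<Sum>i<N. C * q ^ i) \<le> (\<Sum>i. C * q ^ i)"
      by (rule sum_le_suminf) (use q C in \<open>auto intro!: summable_mult summable_geometric\<close>)
    finally show "(\<Sum>n<N. f n) \<le> f 0 + (\<Sum>i. C * q ^ i)"
      by simp
  qed (rule f_nonneg)
  then show ?thesis
    unfolding dirichlet_converges_def f_def by (rule summable_norm_cancel)
qed

text \<open>Infinitely many blocks have at least \<open>e * g powr (x * M)\<close> terms, each at
  least \<open>g powr (- x * Suc M)\<close>. Each such block sums to at least
  \<open>e * g powr - x\<close>, whatever \<open>M\<close> is, against Cauchy's criterion.\<close>

lemma dirichlet_diverges_if_block_bound:
  fixes e x :: real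
  assumes "g \<ge> 2" "x \<ge> 0" "e > 0"
    and bound: "\<exists>\<^sub>\<infinity>M. card (A \<inter> {g ^ M..<g ^ Suc M}) \<ge> e * real g powr (x * M)"
  shows "\<not> dirichlet_converges A (complex_of_real x)"
proof
  assume "dirichlet_converges A (complex_of_real x)"
  define f where "f n = (if n \<in> A then real n powr - x else 0)" for n
  have "dirichlet_term A (complex_of_real x) = (\<lambda>n. complex_of_real (f n))"
    by (simp add: dirichlet_term_of_real f_def fun_eq_iff)
  then have "summable f"
    using \<open>dirichlet_converges _ _\<close> summable_Re[of "\<lambda>n. complex_of_real (f n)"]
    by (simp add: dirichlet_converges_def)
  \<comment> \<open>The factor \<open>g powr - x\<close> is the loss from bounding all elements of a
    block by its upper end \<open>g ^ Suc M\<close>.\<close>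
  define \<delta> where "\<delta> = e * real g powr - x"
  have "\<delta> > 0"
    using assms by (simp add: \<delta>_def)
  then obtain N where N: "\<And>m n. m \<ge> N \<Longrightarrow> norm (sum f {m..<n}) < \<delta>"
    using \<open>summable f\<close> unfolding summable_Cauchy by blast
  obtain M where M: "M > N" "card (A \<inter> {g ^ M..<g ^ Suc M}) \<ge> e * real g powr (x * M)"
    using bound unfolding INFM_nat by blast
  \<comment> \<open>Hence the chosen block starts beyond the Cauchy threshold
    \<open>N\<close>.\<close>
  have "M \<le> g ^ M"
    using assms(1) by (metis less_exp le_less order.trans power_mono zero_le)
  then have small: "norm (sum f {g ^ M..<g ^ Suc M}) < \<delta>"
    using M(1) by (intro N) linarith
  have "\<delta> = e * real g powr (x * M) * real g powr (- x * Suc M)"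
    using assms(1) by (simp add: \<delta>_def powr_add[symmetric] algebra_simps)
  also have "\<dots> \<le> card (A \<inter> {g ^ M..<g ^ Suc M}) * real g powr (- x * Suc M)"
    by (rule mult_right_mono[OF M(2)]) simp
  also have "\<dots> = (\<Sum>n\<in>A \<inter> {g ^ M..<g ^ Suc M}. real g powr (- x * Suc M))"
    by simp
  also have "\<dots> \<le> (\<Sum>n\<in>A \<inter> {g ^ M..<g ^ Suc M}. real n powr - x)"
  proof (rule sum_mono)
    fix n assume n: "n \<in> A \<inter> {g ^ M..<g ^ Suc M}"
    then have "real n \<le> real (g ^ Suc M)"
      by (metis IntD2 atLeastLessThan_iff less_imp_le of_nat_mono)
    moreover have "0 < g ^ M"
      using assms(1) by simp
    then have "0 < n"
      using n by (metis IntD2 atLeastLessThan_iff order_less_le_trans)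
    ultimately have "real (g ^ Suc M) powr - x \<le> real n powr - x"
      using assms(2) by (intro powr_mono2') auto
    moreover have "real (g ^ Suc M) powr - x = real g powr (- x * Suc M)"
      using assms(1) by (simp add: powr_realpow[symmetric] powr_powr mult.commute del: power_Suc of_nat_Suc)
    ultimately show "real g powr (- x * Suc M) \<le> real n powr - x"
      by simp
  qed
  also have "\<dots> = sum f {g ^ M..<g ^ Suc M}"
    by (subst Int_commute, subst sum.inter_restrict) (auto simp: f_def)
  finally show False
    using small by simp
qed

text \<open>Divergence at the real point \<open>x\<close> excludes every bound below
  \<open>x\<close>, and \<open>x\<close> itself is admissible, so the infimum is attained
  there.\<close>

lemma abscissa_of_convergence_eqI:
  assumes "\<And>s. Re s > x \<Longrightarrow> dirichlet_converges A s"
    and "\<not> dirichlet_converges A (complex_of_real x)"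
  shows "abscissa_of_convergence A = ereal x"
  unfolding abscissa_of_convergence_def
proof (rule Inf_eqI)
  fix y assume "y \<in> ereal ` {\<sigma>. \<forall>s. Re s > \<sigma> \<longrightarrow> dirichlet_converges A s}"
  then obtain \<sigma> where \<sigma>: "y = ereal \<sigma>" "\<And>s. Re s > \<sigma> \<Longrightarrow> dirichlet_converges A s"
    by auto
  then have "\<not> \<sigma> < x"
    using assms(2) \<sigma>(2)[of "complex_of_real x"] by auto
  then show "ereal x \<le> y"
    using \<sigma>(1) by simp
qed (use assms(1) in auto)

section \<open>Growth of the digit product\<close>

text \<open>In the logarithm, replacing each frequency by \<open>\<alpha> k * m\<close> costs at
  most \<open>\<beta> * ln (g - k)\<close>. The total error \<open>B\<close> does not depend on
  \<open>m\<close>, so exponentiation turns it into constant factors.\<close>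

lemma digit_product_bounds:
  fixes g :: nat and u :: "nat \<Rightarrow> nat" and \<alpha> :: "nat \<Rightarrow> real"
  assumes "g \<ge> 2" "\<And>i. u i < g" "\<beta> \<ge> 0"
    and dev: "\<And>m k. m \<ge> 1 \<Longrightarrow> k < g \<Longrightarrow> \<bar>real (card {i\<in>{..<m}. u i = k}) - \<alpha> k * real m\<bar> \<le> \<beta>"
  defines "\<sigma> \<equiv> 1 / ln (real g) * (\<Sum>k<g. \<alpha> k * ln (real g - real k))"
  defines "B \<equiv> (\<Sum>k<g. \<beta> * ln (real g - real k))"
  shows "exp (- B) * real g powr (\<sigma> * m) \<le> real (\<Prod>i<m. g - u i)"
    and "real (\<Prod>i<m. g - u i) \<le> exp B * real g powr (\<sigma> * m)"
proof -
  have ln_nonneg: "ln (real g - real k) \<ge> 0" if "k < g" for k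
    using that by (intro ln_ge_zero) linarith
  have pos: "real (\<Prod>i<m. g - u i) > 0"
    unfolding of_nat_prod using assms(2) by (intro prod_pos) auto
  have \<sigma>: "\<sigma> * m * ln (real g) = (\<Sum>k<g. \<alpha> k * m * ln (real g - real k))"
    using assms(1) by (simp add: \<sigma>_def sum_distrib_left mult_ac)
  have ln_prod: "ln (real (\<Prod>i<m. g - u i)) = (\<Sum>k<g. real (card {i\<in>{..<m}. u i = k}) * ln (real g - real k))"
  proof -
    have "ln (real (\<Prod>i<m. g - u i)) = (\<Sum>i<m. ln (real (g - u i)))"
      unfolding of_nat_prod using assms(2) by (intro ln_prod) (simp_all add: not_le assms(2))
    also have "\<dots> = (\<Sum>i<m. ln (real g - real (u i)))"
      using assms(2) by (intro sum.cong) (auto simp: of_nat_diff less_imp_le)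
    also have "\<dots> = (\<Sum>k<g. real (card {i\<in>{..<m}. u i = k}) * ln (real g - real k))"
      by (rule sum_group_by_value) (use assms(2) in auto)
    finally show ?thesis .
  qed
  have "\<bar>ln (real (\<Prod>i<m. g - u i)) - \<sigma> * m * ln (real g)\<bar> \<le> B"
  proof -
    \<comment> \<open>The case \<open>m = 0\<close>, outside the range of \<open>dev\<close>, has
      deviation 0.\<close>
    have dev': "\<bar>real (card {i\<in>{..<m}. u i = k}) - \<alpha> k * m\<bar> \<le> \<beta>" if "k < g" for k
      using dev[of m k] that assms(3) by (cases "m = 0") auto
    have "ln (real (\<Prod>i<m. g - u i)) - \<sigma> * m * ln (real g)
        = (\<Sum>k<g. (real (card {i\<in>{..<m}. u i = k}) - \<alpha> k * m) * ln (real g - real k))"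
      unfolding ln_prod \<sigma> sum_subtractf[symmetric] by (simp add: left_diff_distrib)
    also have "\<bar>\<dots>\<bar> \<le> (\<Sum>k<g. \<bar>(real (card {i\<in>{..<m}. u i = k}) - \<alpha> k * m) * ln (real g - real k)\<bar>)"
      by (rule sum_abs)
    also have "\<dots> \<le> B"
      unfolding B_def
    proof (rule sum_mono)
      fix k assume "k \<in> {..<g}"
      then show "\<bar>(real (card {i\<in>{..<m}. u i = k}) - \<alpha> k * m) * ln (real g - real k)\<bar>
          \<le> \<beta> * ln (real g - real k)"
        using ln_nonneg[of k] dev'[of k] by (auto simp: abs_mult intro: mult_right_mono)
    qed
    finally show ?thesis .
  qed
  then have "- B + \<sigma> * m * ln (real g) \<le> ln (real (\<Prod>i<m. g - u i))"
    and "ln (real (\<Prod>i<m. g - u i)) \<le> B + \<sigma> * m * ln (real g)"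
    by linarith+
  then have "exp (- B + \<sigma> * m * ln (real g)) \<le> exp (ln (real (\<Prod>i<m. g - u i)))"
    and "exp (ln (real (\<Prod>i<m. g - u i))) \<le> exp (B + \<sigma> * m * ln (real g))"
    by (simp_all only: exp_le_cancel_iff)
  moreover have "exp (ln (real (\<Prod>i<m. g - u i))) = real (\<Prod>i<m. g - u i)"
    using pos by (rule exp_ln)
  ultimately show "exp (- B) * real g powr (\<sigma> * m) \<le> real (\<Prod>i<m. g - u i)"
    and "real (\<Prod>i<m. g - u i) \<le> exp B * real g powr (\<sigma> * m)"
    using assms(1) by (simp_all only: exp_add) (simp_all add: powr_def del: of_nat_prod)
qed

section \<open>Abscissa of convergence and divergence at that point\<close>

theorem theorem2:
  fixes g :: nat and U :: "nat \<Rightarrow> nat set"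
    and \<alpha> :: "nat \<Rightarrow> real" and \<beta> :: real and \<epsilon> :: "nat \<Rightarrow> nat \<Rightarrow> real"
    and \<sigma>\<^sub>c :: real
  assumes "g \<ge> 2"
    and "\<And>i. U i \<subset> {0..g-1}"
    and "infinite {m. m \<ge> 1 \<and> U (m - 1) \<noteq> {1..g-1}}"
    and "\<And>k. k \<in> {0..g-1} \<Longrightarrow> \<alpha> k \<ge> 0"
    and "\<beta> \<ge> 0"
    and "\<And>m k. m \<ge> 1 \<Longrightarrow> k \<in> {0..g-1} \<Longrightarrow>
           real (card {i \<in> {0..m-1}. card (U i) = k}) = \<alpha> k * real m + \<epsilon> k m"
    and "\<And>m k. m \<ge> 1 \<Longrightarrow> k \<in> {0..g-1} \<Longrightarrow> \<bar>\<epsilon> k m\<bar> < \<beta>"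
  defines "\<sigma>\<^sub>c \<equiv> 1 / ln (real g) * (\<Sum>k=0..g-1. \<alpha> k * ln (real g - real k))"
  shows "abscissa_of_convergence (missing_digits_set g U) = ereal \<sigma>\<^sub>c
       \<and> \<not> dirichlet_converges (missing_digits_set g U) (complex_of_real \<sigma>\<^sub>c)"
proof -
  let ?A = "missing_digits_set g U"
  define D where "D i = {..<g} - U i" for i
  define B where "B = (\<Sum>k<g. \<beta> * ln (real g - real k))"
  have atMost: "{0..g-1} = {..<g}"
    using assms(1) by auto
  have U: "U i \<subset> {..<g}" for i
    using assms(2)[of i] atMost by simp
  have card_U: "card (U i) < g" for i
    using psubset_card_mono[OF _ U[of i]] by simp
  have D: "D i \<subseteq> {..<g}" for i
    by (auto simp: D_def)
  have card_D: "card (D i) = g - card (U i)" for i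
    unfolding D_def using U[of i] finite_subset[of "U i" "{..<g}"] by (subst card_Diff_subset) auto
  have g1: "g \<ge> 1"
    using assms(1) by simp
  \<comment> \<open>For \<open>m \<ge> 1\<close> the two index ranges coincide, and the deviation is
    \<open>\<epsilon> k m\<close>.\<close>
  have dev: "\<bar>real (card {i\<in>{..<m}. card (U i) = k}) - \<alpha> k * m\<bar> \<le> \<beta>" if "m \<ge> 1" "k < g" for m k
  proof -
    have "k \<in> {0..g-1}" "{..<m} = {0..m-1}"
      using that by auto
    then show ?thesis
      using assms(6)[OF that(1), of k] assms(7)[OF that(1), of k] by simp
  qed
  have \<sigma>: "\<sigma>\<^sub>c = 1 / ln (real g) * (\<Sum>k<g. \<alpha> k * ln (real g - real k))"
    unfolding \<sigma>\<^sub>c_def atMost ..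
  \<comment> \<open>Both block criteria use this sign: the terms then do not increase within a
    block.\<close>
  have "\<sigma>\<^sub>c \<ge> 0"
    unfolding \<sigma> using assms(1,4)
    by (intro mult_nonneg_nonneg sum_nonneg ln_ge_zero divide_nonneg_nonneg) auto
  have card_sums: "card (digit_sums g D m) = (\<Prod>i<m. g - card (U i))" for m
    by (simp add: card_digit_sums[OF g1 D] card_D)
  have lower: "exp (- B) * real g powr (\<sigma>\<^sub>c * m) \<le> card (digit_sums g D m)"
    and upper: "card (digit_sums g D m) \<le> exp B * real g powr (\<sigma>\<^sub>c * m)" for m
    unfolding card_sums \<sigma> B_def
    by (rule digit_product_bounds[OF assms(1) card_U assms(5) dev]; assumption)+
  have conv: "dirichlet_converges ?A s" if "Re s > \<sigma>\<^sub>c" for s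
  proof (rule dirichlet_converges_if_block_bound)
    fix M
    have "?A \<inter> {g ^ M..<g ^ Suc M} \<subseteq> digit_sums g D (Suc M)"
      using missing_digits_block_subset[OF assms(1)] by (auto simp: D_def[abs_def])
    then have "card (?A \<inter> {g ^ M..<g ^ Suc M}) \<le> card (digit_sums g D (Suc M))"
      by (intro card_mono finite_digit_sums[OF g1 D])
    then have "real (card (?A \<inter> {g ^ M..<g ^ Suc M})) \<le> exp B * real g powr (\<sigma>\<^sub>c * Suc M)"
      using upper[of "Suc M"] by linarith
    \<comment> \<open>Elements of block \<open>M\<close> have \<open>Suc M\<close> digits; the extra
      digit is absorbed into the constant.\<close>
    also have "\<dots> = exp B * real g powr \<sigma>\<^sub>c * real g powr (\<sigma>\<^sub>c * M)"
      by (simp add: distrib_left powr_add)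
    finally show "card (?A \<inter> {g ^ M..<g ^ Suc M}) \<le> exp B * real g powr \<sigma>\<^sub>c * real g powr (\<sigma>\<^sub>c * M)" .
  qed (use assms(1) that \<open>\<sigma>\<^sub>c \<ge> 0\<close> in \<open>auto simp: missing_digits_set_def\<close>)
  have block_lower: "exp (- B) * real g powr (\<sigma>\<^sub>c * M) \<le> card (?A \<inter> {g ^ M..<g ^ Suc M})"
    if "U M \<noteq> {1..g-1}" for M
  proof -
    \<comment> \<open>If all nonzero digits were forbidden, properness of \<open>U M\<close> would
      leave 0 allowed, making \<open>U M\<close> exactly the set ruled out here. So some nonzero
      leading digit is available.\<close>
    have "\<not> {1..<g} \<subseteq> U M"
    proof
      assume sub: "{1..<g} \<subseteq> U M"
      have eq: "{..<g} = insert 0 {1..<g}" "{1..<g} = {1..g-1}"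
        using assms(1) by auto
      have "0 \<notin> U M"
        using sub U[of M] eq(1) by auto
      then have "U M \<subseteq> {1..<g}"
        using U[of M] eq(1) by auto
      then show False
        using sub that eq(2) by simp
    qed
    then obtain d where d: "d \<in> {1..<g} - U M"
      by blast
    have "inj_on (\<lambda>a. a + d * g ^ M) (digit_sums g D M)"
      by (simp add: inj_on_def)
    moreover have "(\<lambda>a. a + d * g ^ M) ` digit_sums g D M \<subseteq> ?A \<inter> {g ^ M..<g ^ Suc M}"
      using missing_digits_leading_digit[where U = U and M = M and d = d, OF assms(1) _ d]
      unfolding D_def[abs_def] by blast
    ultimately have "card (digit_sums g D M) \<le> card (?A \<inter> {g ^ M..<g ^ Suc M})"
      by (rule card_inj_on_le) simp
    then show ?thesis
      using lower[of M] by linarith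
  qed
  \<comment> \<open>Hypothesis (i) is indexed by length \<open>m\<close>, the blocks by the leading
    position \<open>M = m - 1\<close>.\<close>
  have "{m. m \<ge> 1 \<and> U (m - 1) \<noteq> {1..g-1}} \<subseteq> Suc ` {M. U M \<noteq> {1..g-1}}"
  proof
    fix m assume "m \<in> {m. m \<ge> 1 \<and> U (m - 1) \<noteq> {1..g-1}}"
    then show "m \<in> Suc ` {M. U M \<noteq> {1..g-1}}"
      by (cases m) auto
  qed
  then have "infinite {M. U M \<noteq> {1..g-1}}"
    using assms(3) finite_surj by blast
  then have "\<exists>\<^sub>\<infinity>M. exp (- B) * real g powr (\<sigma>\<^sub>c * M) \<le> card (?A \<inter> {g ^ M..<g ^ Suc M})"
    unfolding INFM_iff_infinite by (rule infinite_super[rotated]) (use block_lower in blast)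
  then have "\<not> dirichlet_converges ?A (complex_of_real \<sigma>\<^sub>c)"
    using assms(1) \<open>\<sigma>\<^sub>c \<ge> 0\<close> by (intro dirichlet_diverges_if_block_bound[of g _ "exp (- B)"]) auto
  then show ?thesis
    using abscissa_of_convergence_eqI[OF conv] by blast
qed

end
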